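(* Let $A=\mathbb{R}[x]$ be the polynomial ring in one variable, let $B=\mathbb{C}[x]$, and let $\mathbb{H}=\{z\in\mathbb{C} : \mathrm{Im}(z)>0\}$. Then the polar group $\Pi(\mathbb{A}^1_{\mathbb{R}})=\Pi(A)$ is a free abelian group with basis indexed by $\mathbb{H}$, namely the classes $[x-z]$, $z\in\mathbb{H}$.
   Context: For a ring $R$, $R^*$ denotes its unit group. With $K=\mathrm{frac}(A)=\mathbb{R}(x)$ and $L=\mathrm{frac}(B)=\mathbb{C}(x)$, the polar group of $A$ is $\Pi(A)=L^*/B^*K^*$, and $[f]$ denotes the class in $\Pi(A)$ of a nonzero $f\in B$. *)

theory Defs
  imports
    Complex_Main
    "HOL-Algebra.Free_Abelian_Groups"
    "HOL-Algebra.Algebraic_Closure_Type"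
    "HOL-Computational_Algebra.Polynomial_Factorial"
begin

definition unit_group :: "'a::comm_ring_1 monoid" where
  "unit_group = units_of (ring_of_type_algebra :: 'a ring)"

lemma unit_group_simps:
  "carrier (unit_group :: 'a::comm_ring_1 monoid) = {u. u dvd 1}"
  "x \<otimes>\<^bsub>unit_group\<^esub> y = x * (y :: 'a)"
  "\<one>\<^bsub>unit_group\<^esub> = (1 :: 'a)"
  by (auto simp: unit_group_def units_of_def ring_of_type_algebra_def Units_def dvd_def mult.commute)

lemma map_poly_complex_of_real_mult:
  "map_poly complex_of_real (p * q) = map_poly complex_of_real p * map_poly complex_of_real q"
  by (rule poly_eqI) (simp add: coeff_map_poly coeff_mult)

text \<open>The inclusion of \<open>\<real>(x)\<close> into \<open>\<complex>(x)\<close>, defined on the normalized representative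
  and characterized on arbitrary ones by \<open>complex_fract_Fract\<close>.\<close>

definition complex_fract :: "real poly fract \<Rightarrow> complex poly fract" where
  "complex_fract f = (case quot_of_fract f of (p, q) \<Rightarrow>
     Fraction_Field.Fract (map_poly complex_of_real p) (map_poly complex_of_real q))"

lemma complex_fract_Fract:
  assumes "q \<noteq> 0"
  shows "complex_fract (Fraction_Field.Fract p q) =
    Fraction_Field.Fract (map_poly complex_of_real p) (map_poly complex_of_real q)"
proof -
  obtain a b where ab: "quot_of_fract (Fraction_Field.Fract p q) = (a, b)" by fastforce
  have b: "b \<noteq> 0" using snd_quot_of_fract_nonzero[of "Fraction_Field.Fract p q"] ab by simp
  have "Fraction_Field.Fract a b = Fraction_Field.Fract p q"
    using Fract_quot_of_fract[of "Fraction_Field.Fract p q"] ab by simp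
  hence "a * q = p * b" using assms b by (simp add: eq_fract)
  hence "map_poly complex_of_real a * map_poly complex_of_real q =
      map_poly complex_of_real p * map_poly complex_of_real b"
    by (simp flip: map_poly_complex_of_real_mult)
  thus ?thesis using assms b by (simp add: complex_fract_def ab eq_fract map_poly_eq_0_iff)
qed

text \<open>For \<open>A = \<real>[x]\<close>, \<open>B = \<complex>[x]\<close>, \<open>K = frac(A)\<close>, \<open>L = frac(B)\<close>: the product \<open>B\<^sup>*K\<^sup>*\<close> formed
  inside \<open>L\<^sup>*\<close>, and the polar group \<open>L\<^sup>*/B\<^sup>*K\<^sup>*\<close> of \<open>A\<close>.\<close>

definition polar_denominator :: "complex poly fract set" where
  "polar_denominator =
     (to_fract ` carrier (unit_group :: complex poly monoid))
       <#>\<^bsub>unit_group\<^esub>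
     (complex_fract ` carrier (unit_group :: real poly fract monoid))"

definition polar_group :: "complex poly fract set monoid" where
  "polar_group = unit_group Mod polar_denominator"

text \<open>The class \<open>[f]\<close>, meaningful for \<open>f \<noteq> 0\<close>.\<close>

definition polar_class :: "complex poly \<Rightarrow> complex poly fract set" where
  "polar_class f = polar_denominator #>\<^bsub>unit_group\<^esub> to_fract f"

text \<open>\<open>G\<close> is free abelian with basis the family \<open>b\<close> indexed by \<open>I\<close>; in particular
  \<open>b\<close> is injective on \<open>I\<close>.\<close>

definition free_abelian_with_basis ::
    "('g, 'm) monoid_scheme \<Rightarrow> 'i set \<Rightarrow> ('i \<Rightarrow> 'g) \<Rightarrow> bool" where
  "free_abelian_with_basis G I b \<longleftrightarrow>
     comm_group G \<and> (\<exists>h \<in> iso (free_Abelian_group I) G. \<forall>i\<in>I. h (frag_of i) = b i)"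

end

(* To f in \<complex>(x)^* attach the divisor on the upper half plane with coefficient
   ord_z f - ord_{cnj z} f at z.  This is a homomorphism onto the free abelian group on the
   upper half plane, sending x - z to the generator z.  It kills \<complex>^* and \<real>(x)^*, since real
   functions have conjugation-invariant orders.  Conversely, let f = p/q = p cnj(q) / (q cnj(q))
   have trivial divisor.  The denominator is real, and the numerator has the same order at z and
   cnj z for every z; so, once made monic, it has the same roots with multiplicity as its
   conjugate and is therefore real.  Hence the kernel is exactly B^* K^*. *)

theory Submission
  imports Defs
begin

section \<open>Conjugation of complex polynomials and conjugation-invariant roots\<close>

lemma map_poly_cnj_mult: "map_poly cnj (p * q) = map_poly cnj p * map_poly cnj q"
  by (rule poly_eqI) (simp add: coeff_map_poly coeff_mult)

lemma map_poly_cnj_cnj [simp]: "map_poly cnj (map_poly cnj p) = p"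
  by (rule poly_eqI) (simp add: coeff_map_poly)

lemma map_poly_cnj_eq_0_iff [simp]: "map_poly cnj p = 0 \<longleftrightarrow> p = 0"
  by (simp add: map_poly_eq_0_iff)

lemma lead_coeff_map_poly_cnj: "lead_coeff (map_poly cnj p) = cnj (lead_coeff p)"
  by (cases "p = 0") (simp_all add: coeff_map_poly degree_map_poly)

lemma map_poly_cnj_complex_of_real [simp]:
  "map_poly cnj (map_poly complex_of_real p) = map_poly complex_of_real p"
  by (rule poly_eqI) (simp add: coeff_map_poly)

lemma map_poly_complex_of_real_eq_0_iff [simp]: "map_poly complex_of_real p = 0 \<longleftrightarrow> p = 0"
  by (simp add: map_poly_eq_0_iff)

lemma cnj_invariant_poly_is_real:
  assumes "map_poly cnj p = p"
  shows "map_poly complex_of_real (map_poly Re p) = p"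
proof (rule poly_eqI)
  fix n
  have "cnj (coeff p n) = coeff p n"
    by (metis assms coeff_map_poly complex_cnj_zero)
  thus "coeff (map_poly complex_of_real (map_poly Re p)) n = coeff p n"
    by (simp add: coeff_map_poly complex_eq_iff)
qed

lemma linear_power_dvd_map_poly_cnj:
  assumes "[:- z, 1:] ^ n dvd p"
  shows "[:- cnj z, 1:] ^ n dvd map_poly cnj p"
proof -
  have pow: "map_poly cnj ([:- z, 1:] ^ n) = [:- cnj z, 1:] ^ n"
    by (induction n) (simp_all add: map_poly_cnj_mult map_poly_pCons map_poly_1 del: mult_pCons_left)
  from assms obtain r where "p = [:- z, 1:] ^ n * r" by (auto elim: dvdE)
  hence "map_poly cnj p = [:- cnj z, 1:] ^ n * map_poly cnj r"
    by (simp add: map_poly_cnj_mult pow)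
  thus ?thesis by simp
qed

text \<open>Conjugation is an involution taking powers of \<open>[:- z, 1:]\<close> to powers of
  \<open>[:- cnj z, 1:]\<close>, so the same powers divide on both sides. Rewriting this inside the
  definition of the order also covers \<open>p = 0\<close>.\<close>

lemma order_map_poly_cnj: "Polynomial.order (cnj z) (map_poly cnj p) = Polynomial.order z p"
proof -
  have "[:- cnj z, 1:] ^ n dvd map_poly cnj p \<longleftrightarrow> [:- z, 1:] ^ n dvd p" for n
    using linear_power_dvd_map_poly_cnj[of z n p]
      linear_power_dvd_map_poly_cnj[of "cnj z" n "map_poly cnj p"] by auto
  thus ?thesis by (simp only: Polynomial.order_def)
qed

text \<open>Over the complex numbers a nonzero polynomial is its leading coefficient times the
  product of its linear factors, so these data determine it.\<close>

lemma complex_poly_eqI_order: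
  fixes p q :: "complex poly"
  assumes "p \<noteq> 0" "q \<noteq> 0" "lead_coeff p = lead_coeff q"
    and "\<And>z. Polynomial.order z p = Polynomial.order z q"
  shows "p = q"
proof -
  have "{z. poly p z = 0} = {z. poly q z = 0}"
    using assms by (simp add: order_root)
  hence "smult (lead_coeff p) (\<Prod>z | poly p z = 0. [:- z, 1:] ^ Polynomial.order z p) =
      smult (lead_coeff q) (\<Prod>z | poly q z = 0. [:- z, 1:] ^ Polynomial.order z q)"
    by (simp only: assms(3,4))
  thus ?thesis by (simp only: complex_poly_decompose)
qed

lemma order_cnj_invariant_imp_real_multiple:
  fixes p :: "complex poly"
  assumes p: "p \<noteq> 0" and ord: "\<And>z. Polynomial.order (cnj z) p = Polynomial.order z p"
  shows "\<exists>c r. c \<noteq> 0 \<and> p = smult c (map_poly complex_of_real r)"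
proof -
  define c where "c = lead_coeff p"
  \<comment> \<open>Conjugation may change the leading coefficient of \<open>p\<close>, but it fixes
    that of the monic \<open>m\<close>; this allows comparing \<open>m\<close> with its conjugate by
    orders alone.\<close>
  define m where "m = smult (inverse c) p"
  have c: "c \<noteq> 0" using p by (simp add: c_def)
  have m: "m \<noteq> 0" "lead_coeff m = 1" using p c by (simp_all add: m_def c_def)
  have "Polynomial.order z (map_poly cnj m) = Polynomial.order z m" for z
    using order_map_poly_cnj[of "cnj z" m] ord[of z] c by (simp add: m_def order_smult)
  hence "map_poly cnj m = m"
    using m by (intro complex_poly_eqI_order) (simp_all add: lead_coeff_map_poly_cnj)
  hence "map_poly complex_of_real (map_poly Re m) = m" by (rule cnj_invariant_poly_is_real)
  hence "p = smult c (map_poly complex_of_real (map_poly Re m))" using c by (simp add: m_def)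
  thus ?thesis using c by blast
qed

section \<open>Orders of rational functions and the divisor on the upper half plane\<close>

definition fract_order :: "complex \<Rightarrow> complex poly fract \<Rightarrow> int" where
  "fract_order z f = (case quot_of_fract f of (p, q) \<Rightarrow>
     int (Polynomial.order z p) - int (Polynomial.order z q))"

text \<open>Two representatives of a fraction agree after cross-multiplication, and orders add under
  products. So the order may be computed from any representative, not only the normalized
  one.\<close>

lemma fract_order_Fract:
  assumes "p \<noteq> 0" "q \<noteq> 0"
  shows "fract_order z (Fraction_Field.Fract p q) =
    int (Polynomial.order z p) - int (Polynomial.order z q)"
proof -
  obtain a b where ab: "quot_of_fract (Fraction_Field.Fract p q) = (a, b)" by fastforce
  have b: "b \<noteq> 0" using snd_quot_of_fract_nonzero[of "Fraction_Field.Fract p q"] ab by simp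
  have "Fraction_Field.Fract a b = Fraction_Field.Fract p q"
    using Fract_quot_of_fract[of "Fraction_Field.Fract p q"] ab by simp
  hence eq: "a * q = p * b" using assms b by (simp add: eq_fract)
  hence a: "a \<noteq> 0" using assms b by auto
  have "Polynomial.order z (a * q) = Polynomial.order z (p * b)" using eq by simp
  hence "Polynomial.order z a + Polynomial.order z q = Polynomial.order z p + Polynomial.order z b"
    using assms a b by (simp add: order_mult)
  thus ?thesis by (simp add: fract_order_def ab)
qed

lemma fract_nonzeroE:
  fixes f :: "'a::idom fract"
  assumes "f \<noteq> 0"
  obtains p q where "f = Fraction_Field.Fract p q" "p \<noteq> 0" "q \<noteq> 0"
  using assms by (cases f rule: Fract_cases_nonzero) auto

lemma Fract_eq_0_iff: "q \<noteq> 0 \<Longrightarrow> Fraction_Field.Fract p q = 0 \<longleftrightarrow> p = 0"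
  by (simp add: Zero_fract_def eq_fract)

lemma fract_order_mult:
  assumes "f \<noteq> 0" "g \<noteq> 0"
  shows "fract_order z (f * g) = fract_order z f + fract_order z g"
proof -
  from assms obtain p q r s where "f = Fraction_Field.Fract p q" "p \<noteq> 0" "q \<noteq> 0"
      "g = Fraction_Field.Fract r s" "r \<noteq> 0" "s \<noteq> 0"
    by (metis fract_nonzeroE)
  thus ?thesis by (simp add: fract_order_Fract order_mult)
qed

lemma fract_order_to_fract: "p \<noteq> 0 \<Longrightarrow> fract_order z (to_fract p) = int (Polynomial.order z p)"
  by (simp add: to_fract_def fract_order_Fract)

lemma finite_fract_order_nonzero:
  assumes "f \<noteq> 0"
  shows "finite {z. fract_order z f \<noteq> 0}"
proof -
  from assms obtain p q where f: "f = Fraction_Field.Fract p q" "p \<noteq> 0" "q \<noteq> 0"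
    by (rule fract_nonzeroE)
  have "{z. fract_order z f \<noteq> 0} \<subseteq> {z. poly p z = 0} \<union> {z. poly q z = 0}"
    using f by (auto simp: fract_order_Fract order_root)
  moreover have "finite \<dots>" using f by (simp add: poly_roots_finite)
  ultimately show ?thesis by (rule finite_subset)
qed

text \<open>The difference of orders changes sign under conjugation and vanishes on the real line,
  so its values on the upper half plane carry all the information.
  \<open>lookup_polar_divisor\<close> supplies the finite support for nonzero
  \<open>f\<close>.\<close>

definition polar_divisor :: "complex poly fract \<Rightarrow> complex \<Rightarrow>\<^sub>0 int" where
  "polar_divisor f = Abs_poly_mapping
     (\<lambda>z. if Im z > 0 then fract_order z f - fract_order (cnj z) f else 0)"

lemma lookup_polar_divisor:
  assumes "f \<noteq> 0"
  shows "Poly_Mapping.lookup (polar_divisor f) z =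
    (if Im z > 0 then fract_order z f - fract_order (cnj z) f else 0)"
proof -
  let ?S = "{z. fract_order z f \<noteq> 0}"
  \<comment> \<open>A nonzero difference requires a nonzero order at \<open>z\<close> or at
    \<open>cnj z\<close>.\<close>
  have "{z. (if Im z > 0 then fract_order z f - fract_order (cnj z) f else 0) \<noteq> 0} \<subseteq> ?S \<union> cnj ` ?S"
    by (auto split: if_splits simp: image_iff) (metis complex_cnj_cnj)
  moreover have "finite (?S \<union> cnj ` ?S)" using finite_fract_order_nonzero[OF assms] by simp
  ultimately have "finite {z. (if Im z > 0 then fract_order z f - fract_order (cnj z) f else 0) \<noteq> 0}"
    by (rule finite_subset)
  thus ?thesis by (simp add: polar_divisor_def)
qed

lemma keys_polar_divisor: "f \<noteq> 0 \<Longrightarrow> Poly_Mapping.keys (polar_divisor f) \<subseteq> {z. Im z > 0}"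
  by (auto simp: Poly_Mapping.in_keys_iff lookup_polar_divisor split: if_splits)

lemma polar_divisor_mult:
  "f \<noteq> 0 \<Longrightarrow> g \<noteq> 0 \<Longrightarrow> polar_divisor (f * g) = polar_divisor f + polar_divisor g"
  by (rule poly_mapping_eqI) (simp add: lookup_polar_divisor lookup_add fract_order_mult)

lemma polar_divisor_linear:
  assumes "Im z > 0"
  shows "polar_divisor (to_fract [:- z, 1:]) = frag_of z"
proof (rule poly_mapping_eqI)
  fix w
  have *: "Polynomial.order v [:- z, 1:] = (if v = z then 1 else 0)" for v
    using order_power_n_n[of z 1] by (auto intro: order_0I)
  \<comment> \<open>The only zero of the linear factor lies in the upper half plane, so the order at
    \<open>cnj w\<close> contributes nothing there.\<close>
  have "cnj w = z \<longrightarrow> \<not> Im w > 0" using assms by auto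
  thus "Poly_Mapping.lookup (polar_divisor (to_fract [:- z, 1:])) w = Poly_Mapping.lookup (frag_of z) w"
    using assms by (auto simp: lookup_polar_divisor fract_order_to_fract *)
qed

text \<open>Vanishing gives the symmetry directly only for \<open>Im z > 0\<close>; the lower half
  plane follows by exchanging \<open>z\<close> and \<open>cnj z\<close>, and real points are
  fixed.\<close>

lemma polar_divisor_eq_0_iff:
  assumes "f \<noteq> 0"
  shows "polar_divisor f = 0 \<longleftrightarrow> (\<forall>z. fract_order (cnj z) f = fract_order z f)"
proof
  assume 0: "polar_divisor f = 0"
  have upper: "fract_order (cnj z) f = fract_order z f" if "Im z > 0" for z
    using lookup_polar_divisor[OF assms, of z] 0 that by simp
  show "\<forall>z. fract_order (cnj z) f = fract_order z f"
  proof
    fix z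
    consider "Im z > 0" | "Im (cnj z) > 0" | "cnj z = z"
      by (cases "Im z" "0::real" rule: linorder_cases) (auto simp: complex_eq_iff)
    thus "fract_order (cnj z) f = fract_order z f"
      using upper[of z] upper[of "cnj z"] by cases auto
  qed
qed (use assms in \<open>auto intro!: poly_mapping_eqI simp: lookup_polar_divisor\<close>)

section \<open>The polar denominator as the kernel of the divisor map\<close>

lemma carrier_unit_group_field: "carrier (unit_group :: 'a::field monoid) = - {0}"
  by (auto simp: unit_group_simps(1) dvd_field_iff)

lemma comm_group_unit_group_field: "comm_group (unit_group :: 'a::field monoid)"
proof (rule comm_groupI)
  fix x :: 'a assume "x \<in> carrier unit_group"
  thus "\<exists>y\<in>carrier unit_group. y \<otimes>\<^bsub>unit_group\<^esub> x = \<one>\<^bsub>unit_group\<^esub>"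
    by (intro bexI[of _ "inverse x"]) (auto simp: carrier_unit_group_field unit_group_simps(2,3))
qed (auto simp: carrier_unit_group_field unit_group_simps(2,3))

text \<open>The units of the complex polynomial ring are the nonzero constants.\<close>

lemma polar_denominator_altdef:
  "polar_denominator = {to_fract [:c:] * complex_fract g |c g. c \<noteq> 0 \<and> g \<noteq> 0}"
proof -
  have "carrier (unit_group :: complex poly monoid) = {[:c:] |c. c \<noteq> 0}"
    by (auto simp: unit_group_simps(1) is_unit_poly_iff dvd_field_iff)
  thus ?thesis
    by (auto simp: polar_denominator_def set_mult_def carrier_unit_group_field unit_group_simps(2))
qed

lemma complex_fract_nonzero:
  assumes "g \<noteq> 0"
  shows "complex_fract g \<noteq> 0"
  using assms by (rule fract_nonzeroE) (simp add: complex_fract_Fract Fract_eq_0_iff)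

text \<open>Real numerators and denominators equal their own conjugates, so
  \<open>order_map_poly_cnj\<close> compares their orders at \<open>z\<close> and
  \<open>cnj z\<close>.\<close>

lemma fract_order_cnj_complex_fract:
  assumes "g \<noteq> 0"
  shows "fract_order (cnj z) (complex_fract g) = fract_order z (complex_fract g)"
proof -
  have "Polynomial.order (cnj z) (map_poly complex_of_real p) =
      Polynomial.order z (map_poly complex_of_real p)" for p
    using order_map_poly_cnj[of z "map_poly complex_of_real p"] by simp
  thus ?thesis
    using assms by (elim fract_nonzeroE) (simp add: complex_fract_Fract fract_order_Fract)
qed

lemma fract_order_cnj_invariant_imp_polar_denominator:
  assumes f: "f \<noteq> 0" and ord: "\<And>z. fract_order (cnj z) f = fract_order z f"
  shows "f \<in> polar_denominator"
proof -
  from f obtain p q where pq: "f = Fraction_Field.Fract p q" "p \<noteq> 0" "q \<noteq> 0"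
    by (rule fract_nonzeroE)
  \<comment> \<open>Expanding the fraction by the conjugate of \<open>q\<close> makes the
    denominator conjugation-invariant and moves the remaining condition to the numerator.\<close>
  define n d where "n = p * map_poly cnj q" and "d = q * map_poly cnj q"
  have nd: "n \<noteq> 0" "d \<noteq> 0" using pq by (simp_all add: n_def d_def)
  have f_eq: "f = Fraction_Field.Fract n d"
    using pq by (simp add: n_def d_def eq_fract)
  have "Polynomial.order (cnj z) n = Polynomial.order z n" for z
  proof -
    \<comment> \<open>The order of \<open>n\<close> at \<open>z\<close> is that of \<open>p\<close>
      at \<open>z\<close> plus that of \<open>q\<close> at \<open>cnj z\<close>; its symmetry is
      this equation rearranged.\<close>
    have "int (Polynomial.order (cnj z) p) - int (Polynomial.order (cnj z) q) =
        int (Polynomial.order z p) - int (Polynomial.order z q)"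
      using ord[of z] pq by (simp add: fract_order_Fract)
    thus ?thesis
      using order_map_poly_cnj[of z q] order_map_poly_cnj[of "cnj z" q] pq
      by (simp add: n_def order_mult)
  qed
  then obtain c r where c: "c \<noteq> 0" and r: "n = smult c (map_poly complex_of_real r)"
    using order_cnj_invariant_imp_real_multiple[OF nd(1)] by blast
  have "map_poly cnj d = d" by (simp add: d_def map_poly_cnj_mult mult.commute)
  then obtain s where s: "d = map_poly complex_of_real s"
    using cnj_invariant_poly_is_real by metis
  have rs: "r \<noteq> 0" "s \<noteq> 0" using nd r s by auto
  have "f = to_fract [:c:] * complex_fract (Fraction_Field.Fract r s)"
    using rs by (simp add: f_eq r s to_fract_def complex_fract_Fract)
  moreover have "Fraction_Field.Fract r s \<noteq> 0" using rs by (simp add: Fract_eq_0_iff)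
  ultimately show ?thesis using c unfolding polar_denominator_altdef by blast
qed

lemma kernel_polar_divisor:
  "kernel unit_group (free_Abelian_group {z. Im z > 0}) polar_divisor = polar_denominator"
proof -
  have "to_fract [:c:] * complex_fract g \<noteq> 0 \<and>
      polar_divisor (to_fract [:c:] * complex_fract g) = 0" if "c \<noteq> 0" "g \<noteq> 0" for c g
  proof -
    have 0: "to_fract [:c:] \<noteq> 0" "complex_fract g \<noteq> 0"
      using that complex_fract_nonzero by auto
    have "Polynomial.order z [:c:] = 0" for z using that by (simp add: order_0I)
    thus ?thesis
      using 0 that by (simp add: polar_divisor_eq_0_iff fract_order_mult fract_order_to_fract
          fract_order_cnj_complex_fract)
  qed
  hence "polar_denominator \<subseteq> {f. f \<noteq> 0 \<and> polar_divisor f = 0}"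
    by (auto simp: polar_denominator_altdef)
  moreover have "{f. f \<noteq> 0 \<and> polar_divisor f = 0} \<subseteq> polar_denominator"
    by (auto simp: polar_divisor_eq_0_iff intro: fract_order_cnj_invariant_imp_polar_denominator)
  ultimately show ?thesis by (auto simp: kernel_def carrier_unit_group_field)
qed

section \<open>Surjectivity and the induced isomorphism\<close>

lemma group_hom_polar_divisor:
  "group_hom unit_group (free_Abelian_group {z. Im z > 0}) polar_divisor"
  using keys_polar_divisor
  by (simp add: group_hom_def group_hom_axioms_def hom_def carrier_unit_group_field
      unit_group_simps(2) polar_divisor_mult comm_group.axioms(2) comm_group_unit_group_field Pi_def)

text \<open>The image is a subgroup containing every generator, by
  \<open>polar_divisor_linear\<close>; induction over differences of generators then reaches the
  whole free group.\<close>

lemma polar_divisor_surj: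
  "polar_divisor ` carrier unit_group = carrier (free_Abelian_group {z. Im z > 0})"
    (is "?I = carrier ?F")
proof
  interpret group_hom unit_group ?F polar_divisor by (rule group_hom_polar_divisor)
  show "?I \<subseteq> carrier ?F" using hom_closed by blast
  have sub: "subgroup ?I ?F" by (rule img_is_subgroup)
  show "carrier ?F \<subseteq> ?I"
  proof
    fix a assume "a \<in> carrier ?F"
    hence "Poly_Mapping.keys a \<subseteq> {z. Im z > 0}" by simp
    thus "a \<in> ?I"
    proof (induction a rule: frag_induction)
      case zero
      show ?case using subgroup.one_closed[OF sub] by simp
    next
      case (one z)
      have "to_fract [:- z, 1:] \<in> carrier unit_group" by (simp add: carrier_unit_group_field)
      thus ?case using polar_divisor_linear[of z] one by (metis imageI mem_Collect_eq)
    next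
      case (diff a b)
      \<comment> \<open>Membership in the carrier identifies the group inverse of \<open>b\<close>
        with \<open>- b\<close>.\<close>
      have "Poly_Mapping.keys b \<subseteq> {z. Im z > 0}"
        using subgroup.mem_carrier[OF sub diff(2)] by simp
      hence "- b \<in> ?I" using subgroup.m_inv_closed[OF sub diff(2)] by simp
      thus ?case using subgroup.m_closed[OF sub diff(1), of "- b"] by simp
    qed
  qed
qed

theorem mainTheorem4:
  shows "free_abelian_with_basis polar_group {z :: complex. Im z > 0} (\<lambda>z. polar_class [:- z, 1:])"
proof -
  let ?F = "free_Abelian_group {z. Im z > 0}"
  \<comment> \<open>The divisor map is constant on cosets of its kernel, so each image is a
    singleton; \<open>h\<close> is the map of the first isomorphism theorem.\<close>
  define h where "h = (\<lambda>S. the_elem (polar_divisor ` S))"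
  interpret group_hom unit_group ?F polar_divisor by (rule group_hom_polar_divisor)
  have norm: "polar_denominator \<lhd> unit_group"
    using normal_kernel by (simp add: kernel_polar_divisor)
  have grp: "Group.group polar_group"
    unfolding polar_group_def by (rule normal.factorgroup_is_group[OF norm])
  have iso: "h \<in> iso polar_group ?F"
    using FactGroup_iso_set[OF polar_divisor_surj]
    by (simp add: kernel_polar_divisor polar_group_def h_def)
  \<comment> \<open>A basis is witnessed by an isomorphism out of the free group, hence the inverse
    of \<open>h\<close>. By injectivity it suffices that \<open>h\<close> sends the class of the
    linear factor to \<open>frag_of z\<close>.\<close>
  have "inv_into (carrier polar_group) h (frag_of z) = polar_class [:- z, 1:]"
    if z: "Im z > 0" for z
  proof -
    let ?f = "to_fract [:- z, 1:]"
    have f: "?f \<in> carrier unit_group" by (simp add: carrier_unit_group_field)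
    have mem: "polar_class [:- z, 1:] \<in> carrier polar_group"
      using f by (auto simp: polar_class_def polar_group_def FactGroup_def RCOSETS_def)
    have "polar_divisor ` polar_class [:- z, 1:] = {frag_of z}"
    proof -
      have "polar_divisor (g \<otimes>\<^bsub>unit_group\<^esub> ?f) = frag_of z" if "g \<in> polar_denominator" for g
      proof -
        have "g \<in> carrier unit_group" "polar_divisor g = 0"
          using that by (simp_all add: kernel_def flip: kernel_polar_divisor)
        thus ?thesis using f z by (simp add: polar_divisor_linear)
      qed
      \<comment> \<open>Without an element in the coset its image would be empty rather than a
        singleton.\<close>
      moreover have "polar_denominator \<noteq> {}"
        using subgroup.one_closed[OF normal_imp_subgroup[OF norm]] by blast
      ultimately show ?thesis by (auto simp: polar_class_def r_coset_def image_UN)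
    qed
    hence "h (polar_class [:- z, 1:]) = frag_of z" by (simp add: h_def)
    moreover have "inj_on h (carrier polar_group)"
      using iso by (simp add: iso_def bij_betw_def)
    ultimately show ?thesis using mem inv_into_f_f by metis
  qed
  moreover have "inv_into (carrier polar_group) h \<in> iso ?F polar_group"
    by (rule group.iso_set_sym[OF grp iso])
  moreover have "comm_group polar_group"
    unfolding polar_group_def
    by (rule comm_group.abelian_FactGroup[OF comm_group_unit_group_field normal_imp_subgroup[OF norm]])
  ultimately show ?thesis unfolding free_abelian_with_basis_def by blast
qed

end
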